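(* Let $\mathcal{H}\subset\mathbb{C}^n$ be an irreducible hypersurface of degree $d$ with defining irreducible polynomial $f=\sum_{\alpha\in\mathcal{A}}c_\alpha x^\alpha$, and let $a,b,w,\beta,d_w,C,a_{\min},a_{\max},b_{\max},g_{a,b,w},t_0$ be as defined in the context. Suppose that $s\colon(t_0,\infty)\to\mathbb{C}$ is a continuous function such that $g_{a,b,w}(s(t),t)=0$ for all $t>t_0$ and that $s(t)$ diverges to $\infty$ as $t\to\infty$. Let $t_1\ge t_0$ be a number such that if $t>t_1$ then $$|s(t)|\ >\ \frac{2b_{\max}}{a_{\min}}\ \ (\ge 2).$$ Then, for all $t>t_1$, $$|s(t)|^{d-|\beta|}\ \ge\ \frac{t^{d_w}}{C\cdot|\mathcal{A}|}\cdot\left(\frac{a_{\min}}{2(a_{\max}+b_{\max})}\right)^d .$$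
   Context: Let $\mathcal{H}\subset\mathbb{C}^n$ be an irreducible hypersurface, defined by an irreducible polynomial $f=\sum_{\alpha\in\mathcal{A}}c_\alpha x^\alpha\in\mathbb{C}[x_1,\dots,x_n]$, where $\mathcal{A}\subset\mathbb{N}^n$ is finite and $c_\alpha\in\mathbb{C}^\times=\mathbb{C}\setminus\{0\}$ for all $\alpha\in\mathcal{A}$ (so $\mathcal{A}$ is the support of $f$), and $x^\alpha=x_1^{\alpha_1}\cdots x_n^{\alpha_n}$. Let $d=\deg(\mathcal{H})=\deg f$. The Newton polytope of $\mathcal{H}$ is $\mathcal{N}(\mathcal{H})=\mathrm{conv}(\mathcal{A})\subset\mathbb{R}^n$. For $w\in\mathbb{R}^n$, $h(w)=\max\{w\cdot x: x\in\mathcal{N}(\mathcal{H})\}$ is the support function, and $\mathcal{N}(\mathcal{H})_w=\{x\in\mathcal{N}(\mathcal{H}): w\cdot x=h(w)\}$ is the face exposed by $w$. Assume $w\in\mathbb{R}^n$ is such that $\mathcal{N}(\mathcal{H})_w=\{\beta\}$ is a vertex (so $\beta\in\mathcal{A}$), with $\beta=(\beta_1,\dots,\beta_n)$ and $|\beta|=\beta_1+\cdots+\beta_n$. Let $d_w>0$ be a positive number such that $w\cdot\alpha\le h(w)-d_w$ for all $\alpha\in\mathcal{A}\setminus\{\beta\}$. Let $a\in(\mathbb{C}^\times)^n$ and $b\in\mathbb{C}^n$ be general in the sense that, with $\ell_{a,b}(s):=sa-b$ for $s\in\mathbb{C}$, the univariate polynomial $f(\ell_{a,b}(s))$ has $d$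 nondegenerate (simple) roots, and $b_i/a_i\ne b_j/a_j$ whenever $i\ne j$. For $t>0$ and $y\in\mathbb{C}^n$ write $t^w.y:=(t^{w_1}y_1,\dots,t^{w_n}y_n)$, and set $g_{a,b,w}(s,t):=f(t^w.\ell_{a,b}(s))$. Let $t_0>0$ be such that for every $t>t_0$ the polynomial $s\mapsto g_{a,b,w}(s,t)$ has $d$ simple zeroes. Set - $C:=\max\{|c_\alpha|:\alpha\in\mathcal{A}\}/|c_\beta|$, - $a_{\min}:=\min\{1,|a_j|: j=1,\dots,n\}$ and $a_{\max}:=\max\{1,|a_j|: j=1,\dots,n\}$, - $b_{\max}:=\max\{1,|b_j|: j=1,\dots,n\}$. *)

theory Defs
  imports
    "HOL-Analysis.Analysis"
    "HOL-Computational_Algebra.Factorial_Ring"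
    "HOL-Library.Poly_Mapping"
begin

text \<open>
  Multivariate polynomials over the complex numbers in the variables \<open>x\<^sub>i\<close>, \<open>i :: 'n\<close>, are the
  monoid algebra of the additive monoid of exponent vectors \<open>'n \<Rightarrow>\<^sub>0 nat\<close>; the commutative ring
  structure (hence \<open>irreducible\<close>) is the convolution product of \<open>Poly_Mapping\<close>.
  The support of \<open>f\<close> is \<open>Poly_Mapping.keys f\<close>, the coefficient of \<open>x\<^sup>\<alpha>\<close> is \<open>poly_mapping.lookup f \<alpha>\<close>.
\<close>

type_synonym 'n mpolynomial = "('n \<Rightarrow>\<^sub>0 nat) \<Rightarrow>\<^sub>0 complex"

definition mpoly_eval :: "'n::finite mpolynomial \<Rightarrow> complex ^ 'n \<Rightarrow> complex" where
  "mpoly_eval f x = (\<Sum>\<alpha>\<in>Poly_Mapping.keys f. poly_mapping.lookup f \<alpha> * (\<Prod>i\<in>UNIV. (x $ i) ^ poly_mapping.lookup \<alpha> i))"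

definition mdegree :: "('n::finite \<Rightarrow>\<^sub>0 nat) \<Rightarrow> nat" where
  "mdegree \<alpha> = (\<Sum>i\<in>UNIV. poly_mapping.lookup \<alpha> i)"

definition total_degree :: "'n::finite mpolynomial \<Rightarrow> nat" where
  "total_degree f = Max (insert 0 (mdegree ` Poly_Mapping.keys f))"

definition exponent_vec :: "('n::finite \<Rightarrow>\<^sub>0 nat) \<Rightarrow> real ^ 'n" where
  "exponent_vec \<alpha> = (\<chi> i. real (poly_mapping.lookup \<alpha> i))"

definition newton_polytope :: "'n::finite mpolynomial \<Rightarrow> (real ^ 'n) set" where
  "newton_polytope f = convex hull (exponent_vec ` Poly_Mapping.keys f)"

text \<open>
  On a nonempty compact set, in particular on the Newton polytope of a nonzero polynomial,
  the supremum is attained, so it is a maximum.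
\<close>

definition support_function :: "(real ^ 'n) set \<Rightarrow> real ^ 'n::finite \<Rightarrow> real" where
  "support_function P w = (SUP x\<in>P. w \<bullet> x)"

definition exposed_face :: "(real ^ 'n) set \<Rightarrow> real ^ 'n::finite \<Rightarrow> (real ^ 'n) set" where
  "exposed_face P w = {x \<in> P. w \<bullet> x = support_function P w}"

definition line_point :: "complex ^ 'n \<Rightarrow> complex ^ 'n \<Rightarrow> complex \<Rightarrow> complex ^ 'n::finite" where
  "line_point a b s = (\<chi> i. s * a $ i - b $ i)"

definition torus_act :: "real ^ 'n \<Rightarrow> real \<Rightarrow> complex ^ 'n \<Rightarrow> complex ^ 'n::finite" where
  "torus_act w t y = (\<chi> i. complex_of_real (t powr (w $ i)) * y $ i)"

definition g_fun ::
  "'n::finite mpolynomial \<Rightarrow> complex ^ 'n \<Rightarrow> complex ^ 'n \<Rightarrow> real ^ 'n \<Rightarrow> complex \<Rightarrow> real \<Rightarrow> complex" where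
  "g_fun f a b w s t = mpoly_eval f (torus_act w t (line_point a b s))"

text \<open>
  Applied below only to univariate polynomial functions of degree at most \<open>total_degree f\<close>,
  whose simple (nondegenerate) roots are the zeros at which the derivative does not vanish.
\<close>

definition simple_zeros :: "(complex \<Rightarrow> complex) \<Rightarrow> complex set" where
  "simple_zeros p = {s. p s = 0 \<and> deriv p s \<noteq> 0}"

definition coeff_ratio :: "'n::finite mpolynomial \<Rightarrow> ('n \<Rightarrow>\<^sub>0 nat) \<Rightarrow> real" where
  "coeff_ratio f \<beta> = Max ((\<lambda>\<alpha>. norm (poly_mapping.lookup f \<alpha>)) ` Poly_Mapping.keys f) / norm (poly_mapping.lookup f \<beta>)"

definition coord_min :: "complex ^ 'n::finite \<Rightarrow> real" where
  "coord_min a = Min (insert 1 (range (\<lambda>j. norm (a $ j))))"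

definition coord_max :: "complex ^ 'n::finite \<Rightarrow> real" where
  "coord_max a = Max (insert 1 (range (\<lambda>j. norm (a $ j))))"

lemma two_le_threshold:
  fixes a b :: "complex ^ 'n::finite"
  assumes "\<And>i. a $ i \<noteq> 0"
  shows "2 \<le> 2 * coord_max b / coord_min a"
proof -
  have "0 < coord_min a" "coord_min a \<le> 1"
    using assms by (auto simp: coord_min_def)
  moreover have "1 \<le> coord_max b"
    by (simp add: coord_max_def)
  ultimately show ?thesis
    by (simp add: field_simps)
qed

end

theory Submission
  imports Defs
begin

text \<open>
  At a zero \<open>z = s t\<close> of \<open>g_fun f a b w _ t\<close>, the term of \<open>f\<close> at the vertex \<open>\<beta>\<close> cancels against
  all the others.  For \<open>t \<ge> 1\<close> each other term is smaller than the \<open>\<beta>\<close>-term by at least the factor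
  \<open>t powr (- d\<^sub>w)\<close>, as far as the weights \<open>t powr (w \<bullet> \<alpha>)\<close> are concerned; the cancellation therefore
  has to be paid for by the sizes of the monomials in the coordinates \<open>z * a $ i - b $ i\<close>.  Once
  \<open>norm z > 2 * coord_max b / coord_min a\<close>, these coordinates are comparable to \<open>z\<close>:
  they lie between \<open>norm z * (coord_min a / 2)\<close> and \<open>norm z * (coord_max a + coord_max b)\<close>
  (lemma \<open>norm_line_point_bounds\<close>).  So the monomial of \<open>\<beta>\<close> is at least a constant times
  \<open>norm z ^ mdegree \<beta>\<close>, the others are at most a constant times \<open>norm z ^ d\<close>, and comparing them
  bounds \<open>norm z ^ (d - mdegree \<beta>)\<close> below by a constant times \<open>t powr d\<^sub>w\<close>
  (lemma \<open>vertex_term_dominated\<close>).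

  For \<open>t < 1\<close> the weights compare the wrong way round, but then the claim is trivial: \<open>\<beta>\<close>
  is in the support of \<open>f\<close>, so \<open>mdegree \<beta> \<le> d\<close> and the left-hand side is at least \<open>1\<close>, whereas
  every factor on the right-hand side is at most \<open>1\<close>.
\<close>

lemma inj_exponent_vec: "inj exponent_vec"
  by (rule injI, rule poly_mapping_eqI) (simp add: exponent_vec_def vec_eq_iff)

text \<open>
  An exposed face is a face, so a singleton exposed face is an extreme point; and the extreme
  points of a convex hull are among its generators.
\<close>

lemma singleton_exposed_face_in_keys:
  assumes "exposed_face (newton_polytope f) w = {exponent_vec \<beta>}"
  shows "\<beta> \<in> Poly_Mapping.keys f"
proof -
  let ?P = "newton_polytope f"
  have "compact ?P"
    unfolding newton_polytope_def
    by (intro compact_convex_hull finite_imp_compact) simp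
  then have "bdd_above ((\<bullet>) w ` ?P)"
    by (intro bounded_imp_bdd_above compact_imp_bounded compact_continuous_image
        continuous_intros)
  then have le: "w \<bullet> x \<le> support_function ?P w" if "x \<in> ?P" for x
    unfolding support_function_def using that by (rule cSUP_upper2) simp_all
  have "(?P \<inter> {x. w \<bullet> x = support_function ?P w}) face_of ?P"
    using le by (intro face_of_Int_supporting_hyperplane_le)
      (simp_all add: newton_polytope_def convex_convex_hull)
  moreover have "?P \<inter> {x. w \<bullet> x = support_function ?P w} = {exponent_vec \<beta>}"
    using assms by (auto simp: exposed_face_def)
  ultimately have "exponent_vec \<beta> extreme_point_of ?P"
    by (simp add: face_of_singleton)
  then have "exponent_vec \<beta> \<in> exponent_vec ` Poly_Mapping.keys f"
    unfolding newton_polytope_def by (rule extreme_point_of_convex_hull)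
  then show ?thesis
    using inj_exponent_vec by (auto dest: injD)
qed

lemma mdegree_le_total_degree:
  "\<alpha> \<in> Poly_Mapping.keys f \<Longrightarrow> mdegree \<alpha> \<le> total_degree f"
  unfolding total_degree_def by (rule Max_ge) simp_all

lemma norm_monomial_torus_act:
  assumes "t > 0"
  shows "norm (\<Prod>i\<in>UNIV. (torus_act w t y $ i) ^ poly_mapping.lookup \<alpha> i) =
           t powr (w \<bullet> exponent_vec \<alpha>) * (\<Prod>i\<in>UNIV. norm (y $ i) ^ poly_mapping.lookup \<alpha> i)"
proof -
  have "(\<Prod>i\<in>UNIV. (t powr (w $ i)) ^ poly_mapping.lookup \<alpha> i) = t powr (w \<bullet> exponent_vec \<alpha>)"
    using assms
    by (simp add: inner_vec_def exponent_vec_def powr_sum powr_power mult.commute)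
  then show ?thesis
    by (simp add: torus_act_def norm_power norm_mult power_mult_distrib prod.distrib flip: prod_norm)
qed

lemma power_mdegree_le_monomial:
  fixes y :: "'n::finite \<Rightarrow> real"
  assumes "0 \<le> r" and "\<And>i. r \<le> y i"
  shows "r ^ mdegree \<alpha> \<le> (\<Prod>i\<in>UNIV. y i ^ poly_mapping.lookup \<alpha> i)"
  unfolding mdegree_def power_sum by (rule prod_mono) (use assms in \<open>simp add: power_mono\<close>)

lemma monomial_le_power_mdegree:
  fixes y :: "'n::finite \<Rightarrow> real"
  assumes "\<And>i. 0 \<le> y i" and "\<And>i. y i \<le> r"
  shows "(\<Prod>i\<in>UNIV. y i ^ poly_mapping.lookup \<alpha> i) \<le> r ^ mdegree \<alpha>"
  unfolding mdegree_def power_sum by (rule prod_mono) (use assms in \<open>simp add: power_mono\<close>)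

lemma coord_bounds:
  shows "coord_min a \<le> norm (a $ i)" "norm (a $ i) \<le> coord_max a"
    and "coord_min a \<le> 1" "1 \<le> coord_max a"
  unfolding coord_min_def coord_max_def by (rule Min_le Max_ge; simp)+

lemma coord_min_pos: "(\<And>i. a $ i \<noteq> 0) \<Longrightarrow> 0 < coord_min a"
  by (auto simp: coord_min_def)

text \<open>
  The threshold on \<open>norm z\<close> makes \<open>b $ i\<close> at most half as large as \<open>z * a $ i\<close>, which gives
  the lower bound.  It also gives \<open>norm z \<ge> 1\<close>, by which \<open>coord_max b\<close> can be absorbed into
  a multiple of \<open>norm z\<close> in the upper bound.
\<close>

lemma norm_line_point_bounds:
  assumes nz: "\<And>i. a $ i \<noteq> 0" and z: "norm z > 2 * coord_max b / coord_min a"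
  shows "norm z * (coord_min a / 2) \<le> norm (line_point a b z $ i)"
    and "norm (line_point a b z $ i) \<le> norm z * (coord_max a + coord_max b)"
proof -
  have m: "0 < coord_min a"
    using nz by (rule coord_min_pos)
  have z1: "norm z \<ge> 1"
    using two_le_threshold[of a b, OF nz] z by linarith
  have half: "coord_max b \<le> norm z * coord_min a / 2"
    using z m by (simp add: field_simps)
  have b: "norm (b $ i) \<le> coord_max b"
    by (rule coord_bounds)
  have "norm z * coord_min a \<le> norm (z * a $ i)"
    by (simp add: norm_mult mult_left_mono coord_bounds)
  moreover have "norm (z * a $ i) - norm (b $ i) \<le> norm (line_point a b z $ i)"
    unfolding line_point_def by (simp add: norm_triangle_ineq2)
  ultimately show "norm z * (coord_min a / 2) \<le> norm (line_point a b z $ i)"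
    using half b by simp
  have "norm (z * a $ i) \<le> norm z * coord_max a"
    by (simp add: norm_mult mult_left_mono coord_bounds)
  moreover have "norm (line_point a b z $ i) \<le> norm (z * a $ i) + norm (b $ i)"
    unfolding line_point_def by (simp add: norm_triangle_ineq4)
  moreover have "coord_max b \<le> norm z * coord_max b"
    using mult_right_mono[OF z1, of "coord_max b"] coord_bounds(4)[of b] by simp
  ultimately show "norm (line_point a b z $ i) \<le> norm z * (coord_max a + coord_max b)"
    using b by (simp add: algebra_simps)
qed

text \<open>
  The \<open>\<beta>\<close>-term is minus the sum of the others, so the triangle inequality bounds it by the largest
  of them times their number.  For \<open>t \<ge> 1\<close> the gap in \<open>w\<close> turns into the ratio \<open>t powr d\<^sub>w\<close> of
  weights, and \<open>R \<ge> 1\<close> allows one bound \<open>R ^ total_degree f\<close> for the monomials of all degrees.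
\<close>

lemma vertex_term_dominated:
  fixes f :: "'n::finite mpolynomial" and y :: "complex ^ 'n"
  assumes zero: "mpoly_eval f (torus_act w t y) = 0"
    and \<beta>: "\<beta> \<in> Poly_Mapping.keys f"
    and gap: "\<And>\<alpha>. \<alpha> \<in> Poly_Mapping.keys f - {\<beta>} \<Longrightarrow>
                w \<bullet> exponent_vec \<alpha> \<le> w \<bullet> exponent_vec \<beta> - d\<^sub>w"
    and t: "t \<ge> 1"
    and r: "0 \<le> r" "\<And>i. r \<le> norm (y $ i)"
    and R: "1 \<le> R" "\<And>i. norm (y $ i) \<le> R"
  shows "t powr d\<^sub>w * r ^ mdegree \<beta> \<le>
           coeff_ratio f \<beta> * real (card (Poly_Mapping.keys f)) * R ^ total_degree f"
proof -
  let ?A = "Poly_Mapping.keys f"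
  let ?c = "poly_mapping.lookup f"
  let ?T = "\<lambda>\<alpha>. ?c \<alpha> * (\<Prod>i\<in>UNIV. (torus_act w t y $ i) ^ poly_mapping.lookup \<alpha> i)"
  define M where "M = Max ((\<lambda>\<alpha>. norm (?c \<alpha>)) ` ?A)"
  define h where "h = w \<bullet> exponent_vec \<beta>"
  have M: "norm (?c \<alpha>) \<le> M" if "\<alpha> \<in> ?A" for \<alpha>
    unfolding M_def using that by (intro Max_ge) auto
  have M0: "0 \<le> M"
    using M[OF \<beta>] norm_ge_zero order_trans by blast
  have c\<beta>: "0 < norm (?c \<beta>)"
    using \<beta> by (simp add: in_keys_iff)
  have normT: "norm (?T \<alpha>) = norm (?c \<alpha>) *
      (t powr (w \<bullet> exponent_vec \<alpha>) * (\<Prod>i\<in>UNIV. norm (y $ i) ^ poly_mapping.lookup \<alpha> i))" for \<alpha>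
    using t by (subst norm_mult) (simp add: norm_monomial_torus_act)
  have upper: "norm (?T \<alpha>) \<le> M * (t powr (h - d\<^sub>w) * R ^ total_degree f)"
    if \<alpha>: "\<alpha> \<in> ?A - {\<beta>}" for \<alpha>
  proof -
    have "(\<Prod>i\<in>UNIV. norm (y $ i) ^ poly_mapping.lookup \<alpha> i) \<le> R ^ mdegree \<alpha>"
      using R by (intro monomial_le_power_mdegree) simp_all
    also have "\<dots> \<le> R ^ total_degree f"
      using \<alpha> R by (intro power_increasing mdegree_le_total_degree) simp_all
    finally have "(\<Prod>i\<in>UNIV. norm (y $ i) ^ poly_mapping.lookup \<alpha> i) \<le> R ^ total_degree f" .
    moreover have "t powr (w \<bullet> exponent_vec \<alpha>) \<le> t powr (h - d\<^sub>w)"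
      using gap[OF \<alpha>] t unfolding h_def by (rule powr_mono)
    ultimately show ?thesis
      unfolding normT using M[of \<alpha>] M0 \<alpha>
      by (intro mult_mono) (simp_all add: prod_nonneg)
  qed
  have "?T \<beta> + (\<Sum>\<alpha>\<in>?A - {\<beta>}. ?T \<alpha>) = 0"
    using zero \<beta> unfolding mpoly_eval_def by (simp add: sum.remove)
  then have "norm (?T \<beta>) = norm (\<Sum>\<alpha>\<in>?A - {\<beta>}. ?T \<alpha>)"
    by (simp add: eq_neg_iff_add_eq_0[symmetric])
  also have "\<dots> \<le> real (card (?A - {\<beta>})) * (M * (t powr (h - d\<^sub>w) * R ^ total_degree f))"
    using upper by (rule sum_norm_bound)
  also have "\<dots> \<le> real (card ?A) * (M * (t powr (h - d\<^sub>w) * R ^ total_degree f))"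
    using M0 R by (intro mult_right_mono) (simp_all add: card_Diff1_le)
  finally have up: "norm (?T \<beta>) \<le> \<dots>" .
  have "norm (?c \<beta>) * (t powr h * r ^ mdegree \<beta>) \<le> norm (?T \<beta>)"
    unfolding normT h_def
    by (intro mult_left_mono power_mdegree_le_monomial r) simp_all
  also note up
  finally have "t powr (h - d\<^sub>w) * (norm (?c \<beta>) * (t powr d\<^sub>w * r ^ mdegree \<beta>)) \<le>
      t powr (h - d\<^sub>w) * (real (card ?A) * (M * R ^ total_degree f))"
    using t by (simp add: powr_diff field_simps)
  then have "norm (?c \<beta>) * (t powr d\<^sub>w * r ^ mdegree \<beta>) \<le>
      real (card ?A) * (M * R ^ total_degree f)"
    using t by (subst (asm) mult_le_cancel_left_pos) simp_all
  then show ?thesis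
    unfolding coeff_ratio_def M_def[symmetric] using c\<beta> by (simp add: field_simps)
qed

lemma coeff_ratio_ge_1:
  assumes "\<beta> \<in> Poly_Mapping.keys f"
  shows "1 \<le> coeff_ratio f \<beta>"
proof -
  have "norm (poly_mapping.lookup f \<beta>) \<le>
      Max ((\<lambda>\<alpha>. norm (poly_mapping.lookup f \<alpha>)) ` Poly_Mapping.keys f)"
    using assms by (intro Max_ge) auto
  then show ?thesis
    using assms by (simp add: coeff_ratio_def in_keys_iff)
qed

theorem theorem9:
  fixes f :: "'n::finite mpolynomial"
    and a b :: "complex ^ 'n"
    and w :: "real ^ 'n"
    and \<beta> :: "'n \<Rightarrow>\<^sub>0 nat"
    and d :: nat
    and d\<^sub>w t\<^sub>0 t\<^sub>1 :: real
    and s :: "real \<Rightarrow> complex"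
  assumes "irreducible f"
    and "d = total_degree f"
    and "exposed_face (newton_polytope f) w = {exponent_vec \<beta>}"
    and "d\<^sub>w > 0"
    and "\<And>\<alpha>. \<alpha> \<in> Poly_Mapping.keys f - {\<beta>} \<Longrightarrow>
           w \<bullet> exponent_vec \<alpha> \<le> support_function (newton_polytope f) w - d\<^sub>w"
    and "\<And>i. a $ i \<noteq> 0"
    and "card (simple_zeros (\<lambda>z. mpoly_eval f (line_point a b z))) = d"
    and "\<And>i j. i \<noteq> j \<Longrightarrow> b $ i / a $ i \<noteq> b $ j / a $ j"
    and "t\<^sub>0 > 0"
    and "\<And>t. t > t\<^sub>0 \<Longrightarrow> card (simple_zeros (\<lambda>z. g_fun f a b w z t)) = d"
    and "continuous_on {t\<^sub>0<..} s"
    and "\<And>t. t > t\<^sub>0 \<Longrightarrow> g_fun f a b w (s t) t = 0"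
    and "filterlim s at_infinity at_top"
    and "t\<^sub>1 \<ge> t\<^sub>0"
    and "\<And>t. t > t\<^sub>1 \<Longrightarrow> norm (s t) > 2 * coord_max b / coord_min a"
  shows "\<forall>t>t\<^sub>1. norm (s t) powi (int d - int (mdegree \<beta>)) \<ge>
           t powr d\<^sub>w / (coeff_ratio f \<beta> * real (card (Poly_Mapping.keys f))) *
           (coord_min a / (2 * (coord_max a + coord_max b))) ^ d"
proof (intro allI impI)
  fix t assume t: "t > t\<^sub>1"
  define z where "z = norm (s t)"
  define m where "m = coord_min a"
  define Q where "Q = coord_max a + coord_max b"
  define K where "K = coeff_ratio f \<beta> * real (card (Poly_Mapping.keys f))"
  define e where "e = mdegree \<beta>"
  have \<beta>: "\<beta> \<in> Poly_Mapping.keys f"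
    using assms(3) by (rule singleton_exposed_face_in_keys)
  have h: "support_function (newton_polytope f) w = w \<bullet> exponent_vec \<beta>"
    using equalityD2[OF assms(3)] by (simp add: exposed_face_def)
  have e: "e \<le> d"
    unfolding e_def assms(2) using \<beta> by (rule mdegree_le_total_degree)
  have m: "0 < m" "m \<le> 1"
    unfolding m_def using coord_min_pos[OF assms(6)] coord_bounds by simp_all
  have Q: "2 \<le> Q"
    unfolding Q_def using coord_bounds(4)[of a] coord_bounds(4)[of b] by linarith
  have z: "1 \<le> z"
    unfolding z_def using two_le_threshold[of a b, OF assms(6)] assms(15)[OF t] by linarith
  have "1 \<le> card (Poly_Mapping.keys f)"
    using \<beta> by (auto simp: Suc_le_eq card_gt_0_iff)
  then have "1 \<le> real (card (Poly_Mapping.keys f))"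
    by linarith
  then have K: "1 \<le> K"
    unfolding K_def
    using mult_mono[OF coeff_ratio_ge_1[OF \<beta>], of 1 "real (card (Poly_Mapping.keys f))"]
      coeff_ratio_ge_1[OF \<beta>] by linarith
  have powi: "z powi (int d - int e) = z ^ (d - e)"
    using e by (simp flip: of_nat_diff)
  have "t powr d\<^sub>w / K * (m / (2 * Q)) ^ d \<le> z ^ (d - e)"
  proof (cases "t \<ge> 1")
    case False
    then have "t powr d\<^sub>w \<le> 1"
      using t assms(4,9,14) by (intro powr_le1) simp_all
    then have "t powr d\<^sub>w / K \<le> 1"
      using K by (simp add: field_simps)
    moreover have "(m / (2 * Q)) ^ d \<le> 1"
      using m Q by (intro power_le_one) simp_all
    ultimately have "t powr d\<^sub>w / K * (m / (2 * Q)) ^ d \<le> 1"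
      using m Q by (intro mult_le_one) simp_all
    also have "\<dots> \<le> z ^ (d - e)"
      using z by simp
    finally show ?thesis .
  next
    case True
    have "1 \<le> z * Q"
      using mult_mono[OF z, of 1 Q] z Q by simp
    moreover have "mpoly_eval f (torus_act w t (line_point a b (s t))) = 0"
      using assms(12)[of t] t assms(14) unfolding g_fun_def by simp
    ultimately have "t powr d\<^sub>w * (z * (m / 2)) ^ e \<le> K * (z * Q) ^ d"
      unfolding K_def e_def assms(2)
      using norm_line_point_bounds[OF assms(6) assms(15)[OF t]] m z True \<beta> assms(5)
      by (intro vertex_term_dominated) (simp_all add: z_def m_def Q_def h)
    also have "(z * Q) ^ d = z ^ e * (z ^ (d - e) * Q ^ d)"
      using e by (simp add: power_mult_distrib flip: power_add)
    finally have "z ^ e * (t powr d\<^sub>w * (m / 2) ^ e) \<le> z ^ e * (K * (z ^ (d - e) * Q ^ d))"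
      by (simp only: power_mult_distrib mult_ac)
    then have main: "t powr d\<^sub>w * (m / 2) ^ e \<le> K * (z ^ (d - e) * Q ^ d)"
      using z by (subst (asm) mult_le_cancel_left_pos) simp_all
    \<comment> \<open>Lowering the constant from exponent \<open>mdegree \<beta>\<close> to the uniform exponent \<open>d\<close> only
        weakens the bound, because \<open>coord_min a / 2 \<le> 1\<close>.\<close>
    have "(m / 2) ^ d \<le> (m / 2) ^ e"
      using e m by (intro power_decreasing) simp_all
    then have "t powr d\<^sub>w * (m / 2) ^ d \<le> t powr d\<^sub>w * (m / 2) ^ e"
      by (intro mult_left_mono) simp_all
    also note main
    finally have "t powr d\<^sub>w * (m / 2) ^ d / (K * Q ^ d) \<le> z ^ (d - e)"
      using K Q by (simp add: divide_le_eq mult_ac)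
    moreover have "(m / (2 * Q)) ^ d = (m / 2) ^ d / Q ^ d"
      by (simp add: power_divide flip: divide_divide_eq_left)
    ultimately show ?thesis
      by simp
  qed
  then show "norm (s t) powi (int d - int (mdegree \<beta>)) \<ge>
      t powr d\<^sub>w / (coeff_ratio f \<beta> * real (card (Poly_Mapping.keys f))) *
      (coord_min a / (2 * (coord_max a + coord_max b))) ^ d"
    unfolding powi[symmetric] by (simp only: z_def m_def Q_def K_def e_def)
qed

end
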